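(* Let $\Gamma$ be the game over simplices defined in the context. For all sufficiently small $\epsilon>0$ (i.e. there is $\epsilon_0>0$, depending on the game, such that the following holds for every $\epsilon\in(0,\epsilon_0)$) and every $\tau$ with $0<\tau\le\frac{\epsilon}{\max_{i}\{\ln(n_i+1)\}}$, any point $x\in\mathcal{S}^{\tau}$, lifted to $\Delta$ by setting $x_i^{n_i+1}=1-\sum_{j=1}^{n_i}x_i^j$ for each $i\in[N]$, is an $\epsilon$-Nash equilibrium of the game $\Gamma$. Here $\mathcal{S}^{\tau}$ is the set of common stationary points over $\hat{\Delta}^{\tau}$ of the objective functions $l_{i,j}^{\tau}$, $i\in[N]$, $j\in[n_i]$.
   Context: Write $[N]=\{1,\dots,N\}$ and let $n_i\ge 1$ be integers. The game $\Gamma$ has $N$ players. Player $i$ has action set the simplex $\Delta_i=\{x_i=(x_i^1,\dots,x_i^{n_i+1})\in\mathbb{R}_+^{n_i+1}:\sum_{j=1}^{n_i+1}x_i^j=1\}$, and $\Delta=\Delta_1\times\dots\times\Delta_N$. Player $i$ maximizes the utility $f_i:\Delta\to\mathbb{R}$, $f_i(x)=\sum_{k\ne i}x_i^TQ_{ik}x_k+\sum_{j=1}^N r_j^Tx_j$, where $Q_{ik}$ are arbitrary real $(n_i+1)\times(n_k+1)$ matrices and $r_j\in\mathbb{R}^{n_j+1}$. A joint action $x^*\in\Delta$ is an $\epsilon$-Nash equilibrium of $\Gamma$ if $f_i(x_i^*,x_{-i}^* )\ge f_i(x_i,x_{-i}^* )-\epsilon$ for all $i\in[N]$ and all $x_i\in\Delta_i$,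 where $x_{-i}$ denotes the actions of all players other than $i$. Let $\Delta_i^t=\{x_i=(x_i^1,\dots,x_i^{n_i})\in\mathbb{R}_+^{n_i}:\sum_{j=1}^{n_i}x_i^j\le 1\}$, $\Delta^t=\prod_{i=1}^N\Delta_i^t$ (the superscript $t$ stands for "transformed"). For $x\in\Delta^t$, $f_i^t(x)$ is the value of $f_i$ at the lift of $x$ to $\Delta$, obtained by setting $x_k^{n_k+1}=1-\sum_{j=1}^{n_k}x_k^j$ for all $k\in[N]$. Since $f_i$ is affine in each $x_k$ and has no quadratic term in $x_i$, one has $\frac{\partial f_i^t}{\partial x_i^j}(x)=\hat r_i^j+\sum_{k\ne i}\langle\hat q_{ik}^j,x_k\rangle$ for constants $\hat r_i^j\in\mathbb{R}$ and vectors $\hat q_{ik}^j\in\mathbb{R}^{n_k}$ determined by the game. For $\tau>0$, $i\in[N]$, $j\in[n_i]$ define $$l_{i,j}^{\tau}(x)=\Big(\hat r_i^j+\sum_{k\ne i}\langle\hat q_{ik}^j,x_k\rangle-\tau\ln x_i^j+\tau\ln\big(1-\sum_{\ell=1}^{n_i}x_i^\ell\big)\Big)^2.$$ With $M=\max_{i\in[N]}(n_i+1)$, let $\hat{\Delta}^{\tau}=\prod_{i=1}^N\hat{\Delta}_i^{\tau}$, where $$\hat{\Delta}_i^{\tau}=\Big\{x_i\in\mathbb{R}^{n_i}: x_i^j\ge\frac{e^{-1/\tau^2}}{M}\ \forall j\in[n_i],\ \ \sum_{j=1}^{n_i}x_i^j\le 1-\frac{e^{-1/\tau^{1.5}}}{M}\Big\}.$$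 The set of stationary points of $l_{i,j}^{\tau}$ on $\hat{\Delta}^{\tau}$ is $\mathcal{S}_{i,j}^{\tau}=\{x\in\hat{\Delta}^{\tau}:\langle\nabla l_{i,j}^{\tau}(x),y-x\rangle\ge 0\text{ for all }y\in\hat{\Delta}^{\tau}\}$, where $\nabla$ is the full gradient with respect to $x\in\mathbb{R}^{\sum_i n_i}$, and $\mathcal{S}^{\tau}=\bigcap_{i=1}^N\bigcap_{j=1}^{n_i}\mathcal{S}_{i,j}^{\tau}$. *)

theory Defs
  imports "HOL-Analysis.Analysis"
begin

text \<open>
  Players are \<open>1, \<dots>, N\<close>. A joint vector is \<open>x :: nat \<Rightarrow> nat \<Rightarrow> real\<close>, where \<open>x i j\<close> is the \<open>j\<close>-th
  coordinate of the vector of player \<open>i\<close>. The sets below are extensional, so that each of their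
  elements is determined by its coordinates within the index ranges.
\<close>

type_synonym joint = "nat \<Rightarrow> nat \<Rightarrow> real"

definition simplex_of :: "(nat \<Rightarrow> nat) \<Rightarrow> nat \<Rightarrow> (nat \<Rightarrow> real) set" where
  "simplex_of n i = {v \<in> {1..n i + 1} \<rightarrow>\<^sub>E UNIV. (\<forall>j\<in>{1..n i + 1}. v j \<ge> 0) \<and> (\<Sum>j=1..n i + 1. v j) = 1}"

definition joint_simplex :: "nat \<Rightarrow> (nat \<Rightarrow> nat) \<Rightarrow> joint set" where
  "joint_simplex N n = (\<Pi>\<^sub>E i\<in>{1..N}. simplex_of n i)"

text \<open>\<open>Q i k a b\<close> is the \<open>(a, b)\<close> entry of the matrix \<open>Q\<^sub>i\<^sub>k\<close>, and \<open>r i a\<close> the \<open>a\<close>-th entry of \<open>r\<^sub>i\<close>.\<close>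

definition utility ::
  "nat \<Rightarrow> (nat \<Rightarrow> nat) \<Rightarrow> (nat \<Rightarrow> nat \<Rightarrow> nat \<Rightarrow> nat \<Rightarrow> real) \<Rightarrow> (nat \<Rightarrow> nat \<Rightarrow> real) \<Rightarrow> nat \<Rightarrow> joint \<Rightarrow> real"
  where
  "utility N n Q r i x =
     (\<Sum>k\<in>{1..N} - {i}. \<Sum>a=1..n i + 1. \<Sum>b=1..n k + 1. x i a * Q i k a b * x k b)
     + (\<Sum>j=1..N. \<Sum>a=1..n j + 1. r j a * x j a)"

definition eps_nash ::
  "nat \<Rightarrow> (nat \<Rightarrow> nat) \<Rightarrow> (nat \<Rightarrow> nat \<Rightarrow> nat \<Rightarrow> nat \<Rightarrow> real) \<Rightarrow> (nat \<Rightarrow> nat \<Rightarrow> real) \<Rightarrow> real \<Rightarrow> joint \<Rightarrow> bool"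
  where
  "eps_nash N n Q r \<epsilon> x \<longleftrightarrow> x \<in> joint_simplex N n \<and>
     (\<forall>i\<in>{1..N}. \<forall>v\<in>simplex_of n i. utility N n Q r i x \<ge> utility N n Q r i (x(i := v)) - \<epsilon>)"

definition lift_joint :: "nat \<Rightarrow> (nat \<Rightarrow> nat) \<Rightarrow> joint \<Rightarrow> joint" where
  "lift_joint N n x =
     (\<lambda>i\<in>{1..N}. \<lambda>j\<in>{1..n i + 1}. if j = n i + 1 then 1 - (\<Sum>l=1..n i. x i l) else x i j)"

definition utility_t ::
  "nat \<Rightarrow> (nat \<Rightarrow> nat) \<Rightarrow> (nat \<Rightarrow> nat \<Rightarrow> nat \<Rightarrow> nat \<Rightarrow> real) \<Rightarrow> (nat \<Rightarrow> nat \<Rightarrow> real) \<Rightarrow> nat \<Rightarrow> joint \<Rightarrow> real"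
  where
  "utility_t N n Q r i x = utility N n Q r i (lift_joint N n x)"

definition partial_deriv :: "(joint \<Rightarrow> real) \<Rightarrow> nat \<Rightarrow> nat \<Rightarrow> joint \<Rightarrow> real" where
  "partial_deriv g i j x = deriv (\<lambda>t. g (x(i := (x i)(j := t)))) (x i j)"

text \<open>
  The affine coefficients of the partial derivative of \<open>utility_t\<close>, obtained by eliminating the
  last coordinate of every player; \<open>partial_deriv_utility_t\<close> below confirms them.
\<close>

definition r_hat ::
  "nat \<Rightarrow> (nat \<Rightarrow> nat) \<Rightarrow> (nat \<Rightarrow> nat \<Rightarrow> nat \<Rightarrow> nat \<Rightarrow> real) \<Rightarrow> (nat \<Rightarrow> nat \<Rightarrow> real) \<Rightarrow> nat \<Rightarrow> nat \<Rightarrow> real"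
  where
  "r_hat N n Q r i j = r i j - r i (n i + 1)
     + (\<Sum>k\<in>{1..N} - {i}. Q i k j (n k + 1) - Q i k (n i + 1) (n k + 1))"

definition q_hat ::
  "(nat \<Rightarrow> nat) \<Rightarrow> (nat \<Rightarrow> nat \<Rightarrow> nat \<Rightarrow> nat \<Rightarrow> real) \<Rightarrow> nat \<Rightarrow> nat \<Rightarrow> nat \<Rightarrow> nat \<Rightarrow> real"
  where
  "q_hat n Q i k j b = Q i k j b - Q i k (n i + 1) b - Q i k j (n k + 1) + Q i k (n i + 1) (n k + 1)"

definition objective ::
  "nat \<Rightarrow> (nat \<Rightarrow> nat) \<Rightarrow> (nat \<Rightarrow> nat \<Rightarrow> nat \<Rightarrow> nat \<Rightarrow> real) \<Rightarrow> (nat \<Rightarrow> nat \<Rightarrow> real) \<Rightarrow> real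
    \<Rightarrow> nat \<Rightarrow> nat \<Rightarrow> joint \<Rightarrow> real"
  where
  "objective N n Q r \<tau> i j x =
     (r_hat N n Q r i j + (\<Sum>k\<in>{1..N} - {i}. \<Sum>b=1..n k. q_hat n Q i k j b * x k b)
      - \<tau> * ln (x i j) + \<tau> * ln (1 - (\<Sum>l=1..n i. x i l)))\<^sup>2"

definition max_dim :: "nat \<Rightarrow> (nat \<Rightarrow> nat) \<Rightarrow> nat" where
  "max_dim N n = (MAX i\<in>{1..N}. n i + 1)"

definition truncated_simplex :: "nat \<Rightarrow> (nat \<Rightarrow> nat) \<Rightarrow> real \<Rightarrow> nat \<Rightarrow> (nat \<Rightarrow> real) set" where
  "truncated_simplex N n \<tau> i = {v \<in> {1..n i} \<rightarrow>\<^sub>E UNIV.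
     (\<forall>j\<in>{1..n i}. v j \<ge> exp (- (1 / \<tau>\<^sup>2)) / real (max_dim N n)) \<and>
     (\<Sum>j=1..n i. v j) \<le> 1 - exp (- (1 / \<tau> powr 1.5)) / real (max_dim N n)}"

definition truncated_joint :: "nat \<Rightarrow> (nat \<Rightarrow> nat) \<Rightarrow> real \<Rightarrow> joint set" where
  "truncated_joint N n \<tau> = (\<Pi>\<^sub>E i\<in>{1..N}. truncated_simplex N n \<tau> i)"

text \<open>
  The sum below pairs the full gradient, whose coordinates are the \<open>partial_deriv g i j x\<close>, with
  \<open>y - x\<close>. By \<open>objective_partial_differentiable\<close>, \<open>deriv\<close> is never applied at a point of
  non-differentiability when \<open>C\<close> is the truncated set and \<open>g\<close> one of the objectives.
\<close>

definition stationary_points :: "nat \<Rightarrow> (nat \<Rightarrow> nat) \<Rightarrow> joint set \<Rightarrow> (joint \<Rightarrow> real) \<Rightarrow> joint set" where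
  "stationary_points N n C g =
     {x \<in> C. \<forall>y\<in>C. (\<Sum>i=1..N. \<Sum>j=1..n i. partial_deriv g i j x * (y i j - x i j)) \<ge> 0}"

definition common_stationary_points ::
  "nat \<Rightarrow> (nat \<Rightarrow> nat) \<Rightarrow> (nat \<Rightarrow> nat \<Rightarrow> nat \<Rightarrow> nat \<Rightarrow> real) \<Rightarrow> (nat \<Rightarrow> nat \<Rightarrow> real) \<Rightarrow> real \<Rightarrow> joint set"
  where
  "common_stationary_points N n Q r \<tau> =
     (\<Inter>i\<in>{1..N}. \<Inter>j\<in>{1..n i}.
        stationary_points N n (truncated_joint N n \<tau>) (objective N n Q r \<tau> i j))"

lemma utility_t_affine:
  assumes i: "i \<in> {1..N}" and j: "j \<in> {1..n i}"
  shows "utility_t N n Q r i (x(i := (x i)(j := t))) = utility_t N n Q r i x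
    + (t - x i j) * (r_hat N n Q r i j + (\<Sum>k\<in>{1..N} - {i}. \<Sum>b=1..n k. q_hat n Q i k j b * x k b))"
proof -
  let ?x' = "x(i := (x i)(j := t))"
  let ?L = "lift_joint N n x" and ?L' = "lift_joint N n ?x'"
  define d where "d = t - x i j"
  have S: "(\<Sum>l=1..n i. ((x i)(j := t)) l) = (\<Sum>l=1..n i. x i l) + d"
    using j by (simp add: sum.remove[of _ j] d_def)
  have other: "?L' k = ?L k" if "k \<noteq> i" for k
    using that by (auto simp: lift_joint_def fun_eq_iff restrict_def)
  have own: "?L' i a = ?L i a + d * ((if a = j then 1 else 0) - (if a = n i + 1 then 1 else 0))"
    if "a \<in> {1..n i + 1}" for a
    using that i j S by (auto simp: lift_joint_def d_def)
  have lin: "(\<Sum>a=1..n i + 1. ?L' i a * c a) = (\<Sum>a=1..n i + 1. ?L i a * c a) + d * (c j - c (n i + 1))"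
    for c :: "nat \<Rightarrow> real"
  proof -
    have "(\<Sum>a=1..n i + 1. ?L' i a * c a) = (\<Sum>a=1..n i + 1. ?L i a * c a
        + d * ((if a = j then c a else 0) - (if a = n i + 1 then c a else 0)))"
      by (rule sum.cong) (auto simp: own algebra_simps simp del: One_nat_def)
    also have "\<dots> = (\<Sum>a=1..n i + 1. ?L i a * c a)
        + d * ((\<Sum>a=1..n i + 1. if a = j then c a else 0) - (\<Sum>a=1..n i + 1. if a = n i + 1 then c a else 0))"
      by (simp only: sum.distrib sum_distrib_left[symmetric] sum_subtractf)
    also have "\<dots> = (\<Sum>a=1..n i + 1. ?L i a * c a) + d * (c j - c (n i + 1))"
      using j by (subst (1 2) sum.delta) auto
    finally show ?thesis .
  qed
  have row: "(\<Sum>b=1..n k + 1. C b * ?L k b) = C (n k + 1) + (\<Sum>b=1..n k. (C b - C (n k + 1)) * x k b)"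
    if "k \<in> {1..N}" for k and C :: "nat \<Rightarrow> real"
  proof -
    have "(\<Sum>b=1..n k + 1. C b * ?L k b)
        = (\<Sum>b=1..n k. C b * x k b) + C (n k + 1) * (1 - (\<Sum>l=1..n k. x k l))"
      using that by (simp add: lift_joint_def)
    then show ?thesis
      by (simp add: algebra_simps sum_subtractf sum_distrib_left)
  qed
  have quad: "(\<Sum>a=1..n i + 1. \<Sum>b=1..n k + 1. ?L' i a * Q i k a b * ?L' k b)
      = (\<Sum>a=1..n i + 1. \<Sum>b=1..n k + 1. ?L i a * Q i k a b * ?L k b)
        + d * ((Q i k j (n k + 1) - Q i k (n i + 1) (n k + 1)) + (\<Sum>b=1..n k. q_hat n Q i k j b * x k b))"
    if k: "k \<in> {1..N} - {i}" for k
  proof -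
    define c where "c a = (\<Sum>b=1..n k + 1. Q i k a b * ?L k b)" for a
    have "c j - c (n i + 1) = (\<Sum>b=1..n k + 1. (Q i k j b - Q i k (n i + 1) b) * ?L k b)"
      by (simp add: c_def sum_subtractf left_diff_distrib)
    also have "\<dots> = (Q i k j (n k + 1) - Q i k (n i + 1) (n k + 1)) + (\<Sum>b=1..n k. q_hat n Q i k j b * x k b)"
      using k by (subst row) (auto simp: q_hat_def algebra_simps)
    finally have c: "c j - c (n i + 1) = \<dots>" .
    have "(\<Sum>a=1..n i + 1. \<Sum>b=1..n k + 1. ?L' i a * Q i k a b * ?L' k b) = (\<Sum>a=1..n i + 1. ?L' i a * c a)"
      "(\<Sum>a=1..n i + 1. \<Sum>b=1..n k + 1. ?L i a * Q i k a b * ?L k b) = (\<Sum>a=1..n i + 1. ?L i a * c a)"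
      using k other[of k] by (simp_all only: c_def sum_distrib_left mult.assoc) auto
    then show ?thesis using lin[of c] c by simp
  qed
  have linr: "(\<Sum>k=1..N. \<Sum>a=1..n k + 1. r k a * ?L' k a)
      = (\<Sum>k=1..N. \<Sum>a=1..n k + 1. r k a * ?L k a) + d * (r i j - r i (n i + 1))"
  proof -
    have "(\<Sum>k\<in>{1..N} - {i}. \<Sum>a=1..n k + 1. r k a * ?L' k a)
        = (\<Sum>k\<in>{1..N} - {i}. \<Sum>a=1..n k + 1. r k a * ?L k a)"
      by (rule sum.cong) (auto simp: other simp del: sum.cl_ivl_Suc)
    moreover have "(\<Sum>a=1..n i + 1. r i a * ?L' i a)
        = (\<Sum>a=1..n i + 1. r i a * ?L i a) + d * (r i j - r i (n i + 1))"
      using lin[of "r i"] by (simp only: mult.commute)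
    ultimately show ?thesis
      using i by (subst (1 2) sum.remove[of "{1..N}" i]) (auto simp del: sum.cl_ivl_Suc)
  qed
  show ?thesis
    unfolding utility_t_def utility_def r_hat_def linr d_def[symmetric]
    by (simp only: quad cong: sum.cong)
      (simp only: sum.distrib sum_distrib_left[symmetric] distrib_left ac_simps)
qed

lemma partial_deriv_utility_t:
  assumes "i \<in> {1..N}" and "j \<in> {1..n i}"
  shows "((\<lambda>t. utility_t N n Q r i (x(i := (x i)(j := t)))) has_real_derivative
      r_hat N n Q r i j + (\<Sum>k\<in>{1..N} - {i}. \<Sum>b=1..n k. q_hat n Q i k j b * x k b)) (at (x i j))"
    and "partial_deriv (utility_t N n Q r i) i j x =
      r_hat N n Q r i j + (\<Sum>k\<in>{1..N} - {i}. \<Sum>b=1..n k. q_hat n Q i k j b * x k b)"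
proof -
  show *: "((\<lambda>t. utility_t N n Q r i (x(i := (x i)(j := t)))) has_real_derivative
      r_hat N n Q r i j + (\<Sum>k\<in>{1..N} - {i}. \<Sum>b=1..n k. q_hat n Q i k j b * x k b)) (at (x i j))"
    unfolding utility_t_affine[where i = i and j = j and n = n, OF assms] by (auto intro!: derivative_eq_intros)
  show "partial_deriv (utility_t N n Q r i) i j x =
      r_hat N n Q r i j + (\<Sum>k\<in>{1..N} - {i}. \<Sum>b=1..n k. q_hat n Q i k j b * x k b)"
    unfolding partial_deriv_def using * by (rule DERIV_imp_deriv)
qed

lemma objective_partial_differentiable:
  assumes x: "x \<in> truncated_joint N n \<tau>" and N: "N \<ge> 1"
    and i: "i \<in> {1..N}" and j: "j \<in> {1..n i}"
  shows "(\<lambda>t. objective N n Q r \<tau> i j (x(k := (x k)(m := t)))) differentiable (at (x k m))"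
proof -
  have xi: "x i \<in> truncated_simplex N n \<tau> i"
    using x i by (auto simp: truncated_joint_def PiE_iff)
  have "n i + 1 \<le> max_dim N n"
    unfolding max_dim_def using i by (intro Max_ge) auto
  then have M: "real (max_dim N n) > 0" by simp
  have "x i j \<ge> exp (- (1 / \<tau>\<^sup>2)) / real (max_dim N n)"
    using xi j by (simp add: truncated_simplex_def)
  moreover have "exp (- (1 / \<tau>\<^sup>2)) / real (max_dim N n) > 0"
    using M by simp
  ultimately have pos: "x i j > 0" by linarith
  have "(\<Sum>l=1..n i. x i l) \<le> 1 - exp (- (1 / \<tau> powr 1.5)) / real (max_dim N n)"
    using xi by (simp add: truncated_simplex_def)
  moreover have "exp (- (1 / \<tau> powr 1.5)) / real (max_dim N n) > 0"
    using M by simp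
  ultimately have slack: "1 - (\<Sum>l=1..n i. x i l) > 0" by linarith
  let ?y = "\<lambda>t. x(k := (x k)(m := t))"
  have same: "?y (x k m) = x" by simp
  have coord: "(\<lambda>t. ?y t a b) differentiable (at (x k m))" for a b
    by (cases "a = k"; cases "b = m") (auto simp: fun_upd_def)
  have tot: "(\<lambda>t. \<Sum>b\<in>B. c b * ?y t a b) differentiable (at (x k m))"
    if "finite B" for c :: "nat \<Rightarrow> real" and a and B :: "nat set"
    using that by (intro differentiable_sum ballI differentiable_mult differentiable_const coord)
  have ln_diff: "(\<lambda>t. ln (g t)) differentiable (at (x k m))"
    if "g differentiable (at (x k m))" "g (x k m) > 0" for g :: "real \<Rightarrow> real"
  proof -
    from that(1) obtain D where "(g has_real_derivative D) (at (x k m))"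
      by (auto simp: real_differentiable_def)
    from DERIV_chain2[OF DERIV_ln_divide[OF that(2)] this] show ?thesis
      by (auto simp: real_differentiable_def)
  qed
  have ln1: "(\<lambda>t. ln (?y t i j)) differentiable (at (x k m))"
    by (rule ln_diff[OF coord]) (simp only: same pos)
  have "(\<lambda>t. 1 - (\<Sum>l=1..n i. ?y t i l)) differentiable (at (x k m))"
    by (intro differentiable_diff differentiable_const differentiable_sum ballI coord
        finite_atLeastAtMost)
  then have ln2: "(\<lambda>t. ln (1 - (\<Sum>l=1..n i. ?y t i l))) differentiable (at (x k m))"
    by (rule ln_diff) (simp only: same slack)
  have lin: "(\<lambda>t. \<Sum>p\<in>{1..N} - {i}. \<Sum>b=1..n p. q_hat n Q i p j b * ?y t p b)
      differentiable (at (x k m))"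
    by (intro differentiable_sum ballI tot finite_Diff finite_atLeastAtMost)
  show ?thesis
    unfolding objective_def
    by (intro differentiable_power differentiable_add differentiable_diff
        differentiable_mult[OF differentiable_const] differentiable_const ln1 ln2 lin)
qed

end

theory Submission
  imports Defs
begin

text \<open>
  The objectives are squares of residuals
  \<open>h\<^sub>i\<^sub>j = g\<^sub>i\<^sub>j - \<tau> ln x\<^sub>i\<^sub>j + \<tau> ln s\<^sub>i\<close>, where \<open>g\<^sub>i\<^sub>j\<close> is the payoff advantage of action \<open>j\<close> of player
  \<open>i\<close> over that player's last action, and \<open>s\<^sub>i\<close> is the weight of the last action. All residuals
  vanish exactly when every player plays the Gibbs (softmax) response at temperature \<open>\<tau>\<close>.

  At a common stationary point for small \<open>\<tau>\<close> they do vanish. Testing stationarity of \<open>h\<^sub>i\<^sub>j\<^sup>2\<close> with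
  points that differ from \<open>x\<close> only in player \<open>i\<close> gives
  \<open>h\<^sub>i\<^sub>j ((w\<^sub>j - x\<^sub>i\<^sub>j) / x\<^sub>i\<^sub>j + \<Sum>\<^sub>l (w\<^sub>l - x\<^sub>i\<^sub>l) / s\<^sub>i) \<le> 0\<close> for each admissible \<open>w\<close>
  (\<open>stationary_variation\<close>). If \<open>h\<^sub>i\<^sub>j < 0\<close>, this prevents \<open>x\<^sub>i\<^sub>j\<close> from being lowered, so it
  has the minimal value \<open>exp (-1/\<tau>\<^sup>2) / M\<close>. Up to terms \<open>\<tau> ln M\<close> that cancel, \<open>ln x\<^sub>i\<^sub>j\<close> then contributes
  \<open>1/\<tau>\<close> to \<open>h\<^sub>i\<^sub>j\<close>, which beats the contribution of \<open>ln s\<^sub>i\<close>, at least \<open>-1/\<surd>\<tau>\<close>, and the bounded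
  \<open>g\<^sub>i\<^sub>j\<close> (\<open>residual_nonneg\<close>). If \<open>h\<^sub>i\<^sub>j > 0\<close>, then \<open>x\<^sub>i\<^sub>j\<close> can be raised neither at the expense of
  \<open>s\<^sub>i\<close> nor at the expense of another coordinate; so \<open>s\<^sub>i\<close> and the other coordinates are minimal,
  \<open>x\<^sub>i\<^sub>j\<close> is at least \<open>1/M\<close>, and \<open>ln s\<^sub>i\<close> makes \<open>h\<^sub>i\<^sub>j\<close> at most \<open>g\<^sub>i\<^sub>j - 1/\<surd>\<tau> \<le> 0\<close>
  (\<open>residual_nonpos\<close>). Both cases are contradictory. The first one needs the two truncation levels
  to vanish at different rates.

  Finally, when \<open>g\<^sub>i\<^sub>j = \<tau> (ln x\<^sub>i\<^sub>j - ln s\<^sub>i)\<close>, deviating to a mixed action \<open>v\<close> gains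
  \<open>\<tau> (\<Sum> v ln x\<^sub>i - \<Sum> x\<^sub>i ln x\<^sub>i)\<close>, which is at most \<open>\<tau>\<close> times the entropy of \<open>x\<^sub>i\<close>, hence at most
  \<open>\<tau> ln (n\<^sub>i + 1) \<le> \<epsilon>\<close> (\<open>gibbs_response_gain_le\<close>).
\<close>

section \<open>Payoff advantages and residuals\<close>

definition payoff_advantage ::
  "nat \<Rightarrow> (nat \<Rightarrow> nat) \<Rightarrow> (nat \<Rightarrow> nat \<Rightarrow> nat \<Rightarrow> nat \<Rightarrow> real) \<Rightarrow> (nat \<Rightarrow> nat \<Rightarrow> real) \<Rightarrow> nat \<Rightarrow> nat \<Rightarrow> joint \<Rightarrow> real"
  where
  "payoff_advantage N n Q r i j x =
     r_hat N n Q r i j + (\<Sum>k\<in>{1..N} - {i}. \<Sum>b=1..n k. q_hat n Q i k j b * x k b)"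

definition last_weight :: "(nat \<Rightarrow> nat) \<Rightarrow> nat \<Rightarrow> joint \<Rightarrow> real" where
  "last_weight n i x = 1 - (\<Sum>l=1..n i. x i l)"

definition residual ::
  "nat \<Rightarrow> (nat \<Rightarrow> nat) \<Rightarrow> (nat \<Rightarrow> nat \<Rightarrow> nat \<Rightarrow> nat \<Rightarrow> real) \<Rightarrow> (nat \<Rightarrow> nat \<Rightarrow> real) \<Rightarrow> real
    \<Rightarrow> nat \<Rightarrow> nat \<Rightarrow> joint \<Rightarrow> real"
  where
  "residual N n Q r \<tau> i j x =
     payoff_advantage N n Q r i j x - \<tau> * ln (x i j) + \<tau> * ln (last_weight n i x)"

text \<open>
  A crude bound on all payoff advantages that depends on the game alone, so that the threshold for
  \<open>\<epsilon>\<close> built from it serves every \<open>\<tau>\<close> and every stationary point.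
\<close>

definition advantage_bound ::
  "nat \<Rightarrow> (nat \<Rightarrow> nat) \<Rightarrow> (nat \<Rightarrow> nat \<Rightarrow> nat \<Rightarrow> nat \<Rightarrow> real) \<Rightarrow> (nat \<Rightarrow> nat \<Rightarrow> real) \<Rightarrow> real"
  where
  "advantage_bound N n Q r = (\<Sum>i=1..N. \<Sum>j=1..n i.
     \<bar>r_hat N n Q r i j\<bar> + (\<Sum>k\<in>{1..N} - {i}. \<Sum>b=1..n k. \<bar>q_hat n Q i k j b\<bar>))"

lemma objective_eq_residual_power2:
  "objective N n Q r \<tau> i j x = (residual N n Q r \<tau> i j x)\<^sup>2"
  by (simp add: objective_def residual_def payoff_advantage_def last_weight_def)

lemma payoff_advantage_own_update:
  "payoff_advantage N n Q r i j (x(i := v)) = payoff_advantage N n Q r i j x"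
  by (auto simp: payoff_advantage_def intro!: sum.cong)

lemma advantage_bound_nonneg: "advantage_bound N n Q r \<ge> 0"
  unfolding advantage_bound_def by (intro sum_nonneg add_nonneg_nonneg) auto

lemma abs_payoff_advantage_le:
  assumes i: "i \<in> {1..N}" and j: "j \<in> {1..n i}"
    and x: "\<And>k b. k \<in> {1..N} \<Longrightarrow> b \<in> {1..n k} \<Longrightarrow> \<bar>x k b\<bar> \<le> 1"
  shows "\<bar>payoff_advantage N n Q r i j x\<bar> \<le> advantage_bound N n Q r"
proof -
  let ?c = "\<lambda>i j. \<bar>r_hat N n Q r i j\<bar> + (\<Sum>k\<in>{1..N} - {i}. \<Sum>b=1..n k. \<bar>q_hat n Q i k j b\<bar>)"
  have nn: "?c i j \<ge> 0" for i j
    by (intro add_nonneg_nonneg sum_nonneg) auto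
  have "\<bar>\<Sum>k\<in>{1..N} - {i}. \<Sum>b=1..n k. q_hat n Q i k j b * x k b\<bar>
      \<le> (\<Sum>k\<in>{1..N} - {i}. \<Sum>b=1..n k. \<bar>q_hat n Q i k j b\<bar>)"
  proof (intro order_trans[OF sum_abs] sum_mono)
    fix k b assume "k \<in> {1..N} - {i}" "b \<in> {1..n k}"
    then show "\<bar>q_hat n Q i k j b * x k b\<bar> \<le> \<bar>q_hat n Q i k j b\<bar>"
      using x[of k b] by (simp add: abs_mult mult_left_le)
  qed
  then have "\<bar>payoff_advantage N n Q r i j x\<bar> \<le> ?c i j"
    unfolding payoff_advantage_def by linarith
  also have "\<dots> \<le> (\<Sum>j=1..n i. ?c i j)"
    using j nn by (intro member_le_sum) auto
  also have "\<dots> \<le> (\<Sum>i=1..N. \<Sum>j=1..n i. ?c i j)"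
    using i nn by (intro member_le_sum[of i _ "\<lambda>i. \<Sum>j=1..n i. ?c i j"] sum_nonneg) auto
  finally show ?thesis by (simp add: advantage_bound_def)
qed

section \<open>The truncated simplices\<close>

definition coord_floor :: "nat \<Rightarrow> (nat \<Rightarrow> nat) \<Rightarrow> real \<Rightarrow> real" where
  "coord_floor N n \<tau> = exp (- (1 / \<tau>\<^sup>2)) / real (max_dim N n)"

definition slack_floor :: "nat \<Rightarrow> (nat \<Rightarrow> nat) \<Rightarrow> real \<Rightarrow> real" where
  "slack_floor N n \<tau> = exp (- (1 / \<tau> powr 1.5)) / real (max_dim N n)"

lemma truncated_simplex_iff:
  "v \<in> truncated_simplex N n \<tau> i \<longleftrightarrow> v \<in> {1..n i} \<rightarrow>\<^sub>E UNIV \<and>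
     (\<forall>j\<in>{1..n i}. coord_floor N n \<tau> \<le> v j) \<and> slack_floor N n \<tau> \<le> 1 - (\<Sum>j=1..n i. v j)"
  unfolding truncated_simplex_def coord_floor_def slack_floor_def by auto

lemma max_dim_ge: "i \<in> {1..N} \<Longrightarrow> n i + 1 \<le> max_dim N n"
  unfolding max_dim_def by (intro Max_ge) auto

lemma floors_bounds:
  assumes "i \<in> {1..N}"
  shows "0 < coord_floor N n \<tau>" "coord_floor N n \<tau> \<le> 1 / real (max_dim N n)"
    "0 < slack_floor N n \<tau>" "slack_floor N n \<tau> \<le> 1 / real (max_dim N n)"
proof -
  have "real (max_dim N n) > 0"
    using max_dim_ge[OF assms, of n] by simp
  then show "0 < coord_floor N n \<tau>" "coord_floor N n \<tau> \<le> 1 / real (max_dim N n)"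
    "0 < slack_floor N n \<tau>" "slack_floor N n \<tau> \<le> 1 / real (max_dim N n)"
    unfolding coord_floor_def slack_floor_def by (auto intro!: divide_right_mono)
qed

lemma scaled_ln_floors:
  assumes "i \<in> {1..N}" and "\<tau> > 0"
  shows "\<tau> * ln (coord_floor N n \<tau>) = - (1 / \<tau>) - \<tau> * ln (real (max_dim N n))"
    and "\<tau> * ln (slack_floor N n \<tau>) = - (1 / sqrt \<tau>) - \<tau> * ln (real (max_dim N n))"
proof -
  have M: "real (max_dim N n) > 0"
    using max_dim_ge[OF assms(1), of n] by simp
  have "\<tau> * (1 / \<tau>\<^sup>2) = 1 / \<tau>"
    using assms(2) by (simp add: power2_eq_square)
  then show "\<tau> * ln (coord_floor N n \<tau>) = - (1 / \<tau>) - \<tau> * ln (real (max_dim N n))"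
    using M by (simp add: coord_floor_def ln_div right_diff_distrib)
  have "\<tau> powr 1.5 = \<tau> * sqrt \<tau>"
    using assms(2) powr_add[of \<tau> 1 "1/2"] by (simp add: powr_half_sqrt)
  then have "\<tau> * (1 / \<tau> powr 1.5) = 1 / sqrt \<tau>"
    using assms(2) by simp
  then show "\<tau> * ln (slack_floor N n \<tau>) = - (1 / sqrt \<tau>) - \<tau> * ln (real (max_dim N n))"
    using M by (simp add: slack_floor_def ln_div right_diff_distrib)
qed

lemma truncated_joint_bounds:
  assumes x: "x \<in> truncated_joint N n \<tau>" and i: "i \<in> {1..N}"
  shows "x i \<in> truncated_simplex N n \<tau> i"
    and "\<And>j. j \<in> {1..n i} \<Longrightarrow> coord_floor N n \<tau> \<le> x i j"
    and "\<And>j. j \<in> {1..n i} \<Longrightarrow> 0 < x i j"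
    and "\<And>j. j \<in> {1..n i} \<Longrightarrow> x i j \<le> 1"
    and "slack_floor N n \<tau> \<le> last_weight n i x" and "0 < last_weight n i x"
proof -
  show t: "x i \<in> truncated_simplex N n \<tau> i"
    using x i by (auto simp: truncated_joint_def PiE_iff)
  show low: "coord_floor N n \<tau> \<le> x i j" if "j \<in> {1..n i}" for j
    using t that by (simp add: truncated_simplex_iff)
  show pos: "0 < x i j" if "j \<in> {1..n i}" for j
    using low[OF that] floors_bounds(1)[OF i, of n \<tau>] by linarith
  show s: "slack_floor N n \<tau> \<le> last_weight n i x"
    using t by (simp add: truncated_simplex_iff last_weight_def)
  then show s0: "0 < last_weight n i x"
    using floors_bounds(3)[OF i, of n \<tau>] by linarith
  show "x i j \<le> 1" if "j \<in> {1..n i}" for j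
  proof -
    have "x i j \<le> (\<Sum>l=1..n i. x i l)"
      using that pos by (intro member_le_sum) (auto intro: less_imp_le)
    then show ?thesis using s0 by (simp add: last_weight_def)
  qed
qed

section \<open>Variations of one player's action\<close>

lemma residual_partial_derivative:
  assumes x: "x \<in> truncated_joint N n \<tau>" and i: "i \<in> {1..N}"
    and j: "j \<in> {1..n i}" and m: "m \<in> {1..n i}"
  shows "((\<lambda>t. residual N n Q r \<tau> i j (x(i := (x i)(m := t)))) has_real_derivative
    - (\<tau> * ((if m = j then 1 / x i j else 0) + 1 / last_weight n i x))) (at (x i m))"
proof -
  have S: "last_weight n i (x(i := (x i)(m := t))) = last_weight n i x + x i m - t" for t
    using m by (simp add: last_weight_def sum.remove[of _ m])
  have own: "((\<lambda>t. ln (((x i)(m := t)) j)) has_real_derivative (if m = j then 1 / x i j else 0)) (at (x i m))"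
    using truncated_joint_bounds(3)[OF x i j] by (auto intro!: derivative_eq_intros)
  have slack: "((\<lambda>t. ln (last_weight n i x + x i m - t)) has_real_derivative - (1 / last_weight n i x)) (at (x i m))"
    using truncated_joint_bounds(6)[OF x i] by (auto intro!: derivative_eq_intros)
  have "((\<lambda>t. payoff_advantage N n Q r i j x - \<tau> * ln (((x i)(m := t)) j)
      + \<tau> * ln (last_weight n i x + x i m - t)) has_real_derivative
      0 - \<tau> * (if m = j then 1 / x i j else 0) + \<tau> * - (1 / last_weight n i x)) (at (x i m))"
    by (intro DERIV_add DERIV_diff DERIV_const DERIV_cmult own slack)
  moreover have "residual N n Q r \<tau> i j (x(i := (x i)(m := t))) =
      payoff_advantage N n Q r i j x - \<tau> * ln (((x i)(m := t)) j) + \<tau> * ln (last_weight n i x + x i m - t)" for t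
    unfolding residual_def S payoff_advantage_own_update by simp
  moreover have "0 - \<tau> * (if m = j then 1 / x i j else 0) + \<tau> * - (1 / last_weight n i x)
      = - (\<tau> * ((if m = j then 1 / x i j else 0) + 1 / last_weight n i x))"
    by (simp add: algebra_simps)
  ultimately show ?thesis by simp
qed

lemma partial_deriv_objective:
  assumes x: "x \<in> truncated_joint N n \<tau>" and i: "i \<in> {1..N}"
    and j: "j \<in> {1..n i}" and m: "m \<in> {1..n i}"
  shows "partial_deriv (objective N n Q r \<tau> i j) i m x =
    - (2 * \<tau> * residual N n Q r \<tau> i j x * ((if m = j then 1 / x i j else 0) + 1 / last_weight n i x))"
  unfolding partial_deriv_def objective_eq_residual_power2
  by (rule DERIV_imp_deriv)
    (rule derivative_eq_intros residual_partial_derivative[OF assms] refl | simp)+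

text \<open>
  Moving player \<open>i\<close> alone leaves the payoff advantages of that player unchanged, so only the two
  logarithms contribute to the directional derivative of the residual.
\<close>

lemma stationary_variation:
  assumes st: "x \<in> stationary_points N n (truncated_joint N n \<tau>) (objective N n Q r \<tau> i j)"
    and i: "i \<in> {1..N}" and j: "j \<in> {1..n i}" and \<tau>: "\<tau> > 0"
    and w: "w \<in> truncated_simplex N n \<tau> i"
  shows "residual N n Q r \<tau> i j x *
    ((w j - x i j) / x i j + (\<Sum>l=1..n i. w l - x i l) / last_weight n i x) \<le> 0"
proof -
  let ?g = "objective N n Q r \<tau> i j" and ?h = "residual N n Q r \<tau> i j x" and ?s = "last_weight n i x"
  let ?y = "x(i := w)"
  have x: "x \<in> truncated_joint N n \<tau>"
    using st by (simp add: stationary_points_def)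
  have "?y \<in> truncated_joint N n \<tau>"
    using x i w by (auto simp: truncated_joint_def PiE_iff extensional_def)
  then have "0 \<le> (\<Sum>k=1..N. \<Sum>l=1..n k. partial_deriv ?g k l x * (?y k l - x k l))"
    using st unfolding stationary_points_def by blast
  also have "\<dots> = (\<Sum>l=1..n i. partial_deriv ?g i l x * (w l - x i l))"
    using i by (subst sum.remove[of _ i]) (auto intro!: sum.neutral)
  also have "\<dots> = (\<Sum>l=1..n i. - (2 * \<tau> * ?h) *
      ((if l = j then (w l - x i l) / x i j else 0) + (w l - x i l) / ?s))"
    using x i j by (intro sum.cong refl) (simp add: partial_deriv_objective field_simps)
  also have "\<dots> = - (2 * \<tau> * ?h) *
      ((\<Sum>l=1..n i. if l = j then (w l - x i l) / x i j else 0) + (\<Sum>l=1..n i. w l - x i l) / ?s)"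
    by (simp only: sum_distrib_left[symmetric] sum.distrib sum_divide_distrib)
  also have "(\<Sum>l=1..n i. if l = j then (w l - x i l) / x i j else 0) = (w j - x i j) / x i j"
    using j by simp
  finally have "0 \<le> (2 * \<tau>) * - (?h * ((w j - x i j) / x i j + (\<Sum>l=1..n i. w l - x i l) / ?s))"
    by (simp add: algebra_simps)
  then have "(2 * \<tau>) * (?h * ((w j - x i j) / x i j + (\<Sum>l=1..n i. w l - x i l) / ?s)) \<le> (2 * \<tau>) * 0"
    by linarith
  then show ?thesis
    by (rule mult_left_le_imp_le) (use \<tau> in simp)
qed

section \<open>Common stationary points have zero residuals\<close>

text \<open>
  A negative residual forces \<open>x i j\<close> to its floor. There \<open>- \<tau> ln (x i j)\<close> is of order \<open>1 / \<tau>\<close>, more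
  than the slack term, of order \<open>1 / \<surd>\<tau>\<close> at worst, and the payoff advantage can offset.
\<close>

lemma residual_nonneg:
  assumes st: "x \<in> stationary_points N n (truncated_joint N n \<tau>) (objective N n Q r \<tau> i j)"
    and i: "i \<in> {1..N}" and j: "j \<in> {1..n i}" and \<tau>: "\<tau> > 0"
    and small: "advantage_bound N n Q r + 2 \<le> 1 / sqrt \<tau>"
  shows "residual N n Q r \<tau> i j x \<ge> 0"
proof (rule ccontr)
  let ?h = "residual N n Q r \<tau> i j x" and ?a = "coord_floor N n \<tau>"
  assume "\<not> ?h \<ge> 0"
  then have neg: "?h < 0" by simp
  have x: "x \<in> truncated_joint N n \<tau>"
    using st by (simp add: stationary_points_def)
  note b = truncated_joint_bounds[OF x i]
  have at_floor: "x i j = ?a"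
  proof (rule ccontr)
    assume "x i j \<noteq> ?a"
    then have gt: "?a < x i j" using b(2)[OF j] by simp
    \<comment> \<open>Lowering coordinate \<open>j\<close> alone frees slack, so the sum constraint is kept.\<close>
    define w where "w = (x i)(j := ?a)"
    have sum_w: "(\<Sum>l=1..n i. w l - x i l) = ?a - x i j"
      using j by (simp add: w_def sum.remove[of _ j])
    have w: "w \<in> truncated_simplex N n \<tau> i"
      using b(1) gt sum_w j by (auto simp: truncated_simplex_iff sum_subtractf w_def PiE_iff extensional_def)
    have "?h * ((?a - x i j) / x i j + (?a - x i j) / last_weight n i x) \<le> 0"
      using stationary_variation[OF st i j \<tau> w, unfolded sum_w] by (simp add: w_def)
    moreover have "(?a - x i j) / x i j < 0" "(?a - x i j) / last_weight n i x < 0"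
      using gt b(3)[OF j] b(6) by (auto intro: divide_neg_pos)
    ultimately show False
      using neg by (simp add: mult_le_0_iff)
  qed
  have "\<bar>payoff_advantage N n Q r i j x\<bar> \<le> advantage_bound N n Q r"
    using truncated_joint_bounds(3,4)[OF x] by (intro abs_payoff_advantage_le i j) force
  moreover have "\<tau> * ln (slack_floor N n \<tau>) \<le> \<tau> * ln (last_weight n i x)"
    using b(5) floors_bounds(3)[OF i, of n \<tau>] \<tau> by simp
  \<comment> \<open>The summand 2 in \<open>small\<close> makes half of \<open>1 / \<tau>\<close> absorb the slack term.\<close>
  moreover have "1 / \<tau> - 1 / sqrt \<tau> \<ge> 1 / sqrt \<tau>"
  proof -
    have "1 / \<tau> = (1 / sqrt \<tau>) * (1 / sqrt \<tau>)" using \<tau> by simp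
    moreover have "2 * (1 / sqrt \<tau>) \<le> (1 / sqrt \<tau>) * (1 / sqrt \<tau>)"
      using small advantage_bound_nonneg[of N n Q r] \<tau> by (intro mult_right_mono) auto
    ultimately show ?thesis by linarith
  qed
  ultimately have "?h \<ge> 0"
    using scaled_ln_floors[OF i \<tau>, of n] small by (simp add: residual_def at_floor)
  then show False using neg by simp
qed

text \<open>
  A positive residual forces the last weight and all coordinates other than \<open>x i j\<close> to their floors.
  Then \<open>x i j\<close> is so large that its logarithm is harmless, and the slack term, of order
  \<open>- 1 / \<surd>\<tau>\<close>, outweighs the payoff advantage.
\<close>

lemma residual_nonpos:
  assumes st: "x \<in> stationary_points N n (truncated_joint N n \<tau>) (objective N n Q r \<tau> i j)"
    and i: "i \<in> {1..N}" and j: "j \<in> {1..n i}" and \<tau>: "\<tau> > 0"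
    and small: "advantage_bound N n Q r + 2 \<le> 1 / sqrt \<tau>"
  shows "residual N n Q r \<tau> i j x \<le> 0"
proof (rule ccontr)
  let ?h = "residual N n Q r \<tau> i j x"
  let ?a = "coord_floor N n \<tau>" and ?b = "slack_floor N n \<tau>" and ?s = "last_weight n i x"
  let ?M = "real (max_dim N n)"
  assume "\<not> ?h \<le> 0"
  then have pos: "?h > 0" by simp
  have x: "x \<in> truncated_joint N n \<tau>"
    using st by (simp add: stationary_points_def)
  note b = truncated_joint_bounds[OF x i]
  have slack: "?s = ?b"
  proof (rule ccontr)
    assume "?s \<noteq> ?b"
    then have d: "0 < ?s - ?b" using b(5) by simp
    define w where "w = (x i)(j := x i j + (?s - ?b))"
    have sum_w: "(\<Sum>l=1..n i. w l - x i l) = ?s - ?b"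
      using j by (simp add: w_def sum.remove[of _ j])
    then have "(\<Sum>l=1..n i. w l) = 1 - ?b"
      by (simp add: sum_subtractf last_weight_def)
    then have w: "w \<in> truncated_simplex N n \<tau> i"
      using b(1) add_increasing2[OF less_imp_le[OF d] b(2)[OF j]] j
      by (auto simp: truncated_simplex_iff w_def PiE_iff extensional_def)
    have "?h * ((?s - ?b) / x i j + (?s - ?b) / ?s) \<le> 0"
      using stationary_variation[OF st i j \<tau> w, unfolded sum_w] by (simp add: w_def)
    moreover have "(?s - ?b) / x i j > 0" "(?s - ?b) / ?s > 0"
      using d b(3)[OF j] b(6) by auto
    ultimately show False
      using pos by (simp add: mult_le_0_iff)
  qed
  have others: "x i m = ?a" if m: "m \<in> {1..n i} - {j}" for m
  proof (rule ccontr)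
    assume "x i m \<noteq> ?a"
    then have d: "0 < x i m - ?a" using b(2)[of m] m by simp
    \<comment> \<open>A transfer from \<open>m\<close> to \<open>j\<close> fixes the sum, which removes the slack term of the variation.\<close>
    define w where "w = (x i)(j := x i j + (x i m - ?a), m := ?a)"
    have sum_w: "(\<Sum>l=1..n i. w l - x i l) = 0"
    proof -
      have "(\<Sum>l=1..n i. w l - x i l) =
          (w j - x i j) + ((w m - x i m) + (\<Sum>l\<in>{1..n i} - {j} - {m}. w l - x i l))"
        using j m by (simp add: sum.remove[of _ j] sum.remove[of _ m])
      also have "(\<Sum>l\<in>{1..n i} - {j} - {m}. w l - x i l) = 0"
        by (intro sum.neutral) (auto simp: w_def)
      finally show ?thesis using m by (simp add: w_def)
    qed
    then have w: "w \<in> truncated_simplex N n \<tau> i"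
      using b(1) add_increasing2[OF less_imp_le[OF d] b(2)[OF j]] j m
      by (auto simp: truncated_simplex_iff w_def sum_subtractf PiE_iff extensional_def)
    have "?h * ((x i m - ?a) / x i j) \<le> 0"
      using stationary_variation[OF st i j \<tau> w, unfolded sum_w] m by (simp add: w_def)
    moreover have "?h * ((x i m - ?a) / x i j) > 0"
      using pos d b(3)[OF j] by auto
    ultimately show False by linarith
  qed
  have nM: "real (n i) + 1 \<le> ?M"
    using max_dim_ge[OF i, of n] by linarith
  \<comment> \<open>All the \<open>n i\<close> other weights, the last one included, are at floors of size at most \<open>1 / M\<close>.\<close>
  have large: "1 / ?M \<le> x i j"
  proof -
    have "(\<Sum>l=1..n i. x i l) = x i j + (\<Sum>l\<in>{1..n i} - {j}. ?a)"
      using j others by (simp add: sum.remove[of _ j])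
    then have "x i j = 1 - ?b - (real (n i) - 1) * ?a"
      using slack j by (simp add: last_weight_def of_nat_diff)
    moreover have "(real (n i) - 1) * ?a \<le> (real (n i) - 1) * (1 / ?M)"
      using floors_bounds(2)[OF i, of n \<tau>] j by (intro mult_left_mono) auto
    moreover have "1 - 1 / ?M - (real (n i) - 1) * (1 / ?M) \<ge> 1 / ?M"
      using nM by (simp add: field_simps)
    ultimately show ?thesis
      using floors_bounds(4)[OF i, of n \<tau>] by linarith
  qed
  have "ln (1 / ?M) \<le> ln (x i j)"
    using large nM b(3)[OF j] by (subst ln_le_cancel_iff) auto
  then have "- ln ?M \<le> ln (x i j)"
    using nM by (simp add: ln_div)
  then have "\<tau> * (- ln ?M) \<le> \<tau> * ln (x i j)"
    using \<tau> by (intro mult_left_mono) auto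
  moreover have "\<bar>payoff_advantage N n Q r i j x\<bar> \<le> advantage_bound N n Q r"
    using truncated_joint_bounds(3,4)[OF x] by (intro abs_payoff_advantage_le i j) force
  ultimately have "?h \<le> 0"
    using scaled_ln_floors(2)[OF i \<tau>, of n] small by (simp add: residual_def slack)
  then show False using pos by simp
qed

section \<open>Zero residuals give an approximate equilibrium\<close>

text \<open>
  The marginal payoffs of player \<open>i\<close> do not depend on that player's own action, so changing the
  coordinates one at a time never alters the slopes met later, and the gains add up.
\<close>

lemma utility_t_deviation:
  assumes i: "i \<in> {1..N}"
  shows "utility_t N n Q r i (x(i := v)) = utility_t N n Q r i x
    + (\<Sum>j=1..n i. (v j - x i j) * payoff_advantage N n Q r i j x)"
proof -
  define z where "z m = x(i := (\<lambda>j. if j \<in> {1..m} then v j else x i j))" for m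
  have step: "m \<le> n i \<Longrightarrow> utility_t N n Q r i (z m) = utility_t N n Q r i x
      + (\<Sum>j=1..m. (v j - x i j) * payoff_advantage N n Q r i j x)" for m
  proof (induction m)
    case 0
    then show ?case by (simp add: z_def)
  next
    case (Suc m)
    have "z (Suc m) = (z m)(i := (z m i)(Suc m := v (Suc m)))"
      by (auto simp: z_def fun_eq_iff)
    then have "utility_t N n Q r i (z (Suc m)) = utility_t N n Q r i (z m)
        + (v (Suc m) - z m i (Suc m)) * payoff_advantage N n Q r i (Suc m) (z m)"
      using utility_t_affine[OF i, of "Suc m" n Q r "z m" "v (Suc m)"] Suc.prems
      by (simp add: payoff_advantage_def)
    moreover have "z m i (Suc m) = x i (Suc m)"
      by (simp add: z_def)
    moreover have "payoff_advantage N n Q r i (Suc m) (z m) = payoff_advantage N n Q r i (Suc m) x"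
      unfolding z_def by (rule payoff_advantage_own_update)
    ultimately show ?case
      using Suc by simp
  qed
  have "lift_joint N n (z (n i)) = lift_joint N n (x(i := v))"
    by (auto simp: z_def lift_joint_def fun_eq_iff restrict_def)
  then show ?thesis
    using step[of "n i"] by (simp add: utility_t_def)
qed

lemma lift_joint_update_simplex:
  assumes "i \<in> {1..N}" and "v \<in> simplex_of n i"
  shows "(lift_joint N n x)(i := v) = lift_joint N n (x(i := v))"
proof -
  have "v (n i + 1) = 1 - (\<Sum>l=1..n i. v l)" "\<And>j. j \<notin> {1..n i + 1} \<Longrightarrow> v j = undefined"
    using assms(2) by (auto simp: simplex_of_def PiE_iff extensional_def)
  then show ?thesis
    using assms(1) by (auto simp: lift_joint_def fun_eq_iff restrict_def)
qed

lemma lift_truncated_joint: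
  assumes x: "x \<in> truncated_joint N n \<tau>"
  shows "lift_joint N n x \<in> joint_simplex N n"
proof -
  have "0 \<le> x i j" if "i \<in> {1..N}" "j \<in> {1..n i}" for i j
    using truncated_joint_bounds(3)[OF x that] by simp
  moreover have "0 \<le> 1 - (\<Sum>l=1..n i. x i l)" if "i \<in> {1..N}" for i
    using truncated_joint_bounds(6)[OF x that] by (simp add: last_weight_def)
  ultimately show ?thesis
    by (auto simp: joint_simplex_def simplex_of_def lift_joint_def PiE_iff)
qed

text \<open>
  Summing \<open>ln y \<le> y - 1\<close> at \<open>y = 1 / (K p)\<close> with weights \<open>p\<close>, where \<open>K\<close> is the number of outcomes,
  makes the right-hand sides cancel.
\<close>

lemma entropy_le_ln_card:
  fixes p :: "'a \<Rightarrow> real"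
  assumes fin: "finite A" and pos: "\<And>a. a \<in> A \<Longrightarrow> p a > 0" and one: "(\<Sum>a\<in>A. p a) = 1"
  shows "- (\<Sum>a\<in>A. p a * ln (p a)) \<le> ln (real (card A))"
proof -
  let ?K = "real (card A)"
  have K: "?K > 0"
    using fin one by (cases "A = {}") (auto simp: card_gt_0_iff)
  have "- (p a * ln (p a)) - p a * ln ?K \<le> 1 / ?K - p a" if a: "a \<in> A" for a
  proof -
    have "- ln (p a) - ln ?K = ln (1 / (?K * p a))"
      using K pos[OF a] by (simp add: ln_div ln_mult)
    also have "\<dots> \<le> 1 / (?K * p a) - 1"
      using K pos[OF a] by (intro ln_le_minus_one) simp
    finally have "p a * (- ln (p a) - ln ?K) \<le> p a * (1 / (?K * p a) - 1)"
      using pos[OF a] by (intro mult_left_mono) auto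
    also have "\<dots> = 1 / ?K - p a"
      using K pos[OF a] by (simp add: right_diff_distrib)
    finally show ?thesis by (simp add: algebra_simps)
  qed
  then have "(\<Sum>a\<in>A. - (p a * ln (p a)) - p a * ln ?K) \<le> (\<Sum>a\<in>A. 1 / ?K - p a)"
    by (rule sum_mono)
  then show ?thesis
    using K one by (simp add: sum_subtractf sum_negf sum_distrib_right[symmetric])
qed

text \<open>
  Zero residuals say that the payoff of action \<open>j\<close> is \<open>\<tau> ln (p j)\<close> up to a constant common to all
  actions of the player, the last one included. Deviating from \<open>p\<close> to \<open>v\<close> therefore gains
  \<open>\<tau> (\<Sum> v ln p - \<Sum> p ln p)\<close>, where the first sum is at most \<open>0\<close> and minus the second is an entropy.
\<close>

lemma gibbs_response_gain_le:
  assumes x: "x \<in> truncated_joint N n \<tau>" and i: "i \<in> {1..N}" and \<tau>: "\<tau> > 0"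
    and zero: "\<And>j. j \<in> {1..n i} \<Longrightarrow> residual N n Q r \<tau> i j x = 0"
    and v: "v \<in> simplex_of n i"
  shows "utility N n Q r i ((lift_joint N n x)(i := v))
    \<le> utility N n Q r i (lift_joint N n x) + \<tau> * ln (real (n i + 1))"
proof -
  let ?s = "last_weight n i x"
  define p where "p = lift_joint N n x i"
  have p: "p \<in> simplex_of n i"
    using lift_truncated_joint[OF x] i by (auto simp: p_def joint_simplex_def)
  have p_eq: "p j = x i j" if "j \<in> {1..n i}" for j
    using that i by (simp add: p_def lift_joint_def)
  have p_last: "p (n i + 1) = ?s"
    using i by (simp add: p_def lift_joint_def last_weight_def)
  have p_pos: "p j > 0" if "j \<in> {1..n i + 1}" for j
    using that p_eq[of j] p_last truncated_joint_bounds(3,6)[OF x i] by (cases "j = n i + 1") auto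
  have p_le: "p j \<le> 1" if "j \<in> {1..n i + 1}" for j
    using p that member_le_sum[of j "{1..n i + 1}" p] by (auto simp: simplex_of_def)
  have sums: "(\<Sum>j=1..n i. p j) + p (n i + 1) = 1" "(\<Sum>j=1..n i. v j) + v (n i + 1) = 1"
    using p v by (auto simp: simplex_of_def)
  have adv: "payoff_advantage N n Q r i j x = \<tau> * (ln (p j) - ln ?s)" if "j \<in> {1..n i}" for j
    using zero[OF that] p_eq[OF that] by (simp add: residual_def algebra_simps)
  have "(\<Sum>j=1..n i. (v j - x i j) * payoff_advantage N n Q r i j x)
      = (\<Sum>j=1..n i. \<tau> * ((v j - p j) * ln (p j)) - \<tau> * ln ?s * (v j - p j))"
    by (intro sum.cong refl) (simp add: adv p_eq algebra_simps)
  also have "\<dots> = \<tau> * (\<Sum>j=1..n i. (v j - p j) * ln (p j))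
      - \<tau> * ln ?s * ((\<Sum>j=1..n i. v j) - (\<Sum>j=1..n i. p j))"
    by (simp only: sum_subtractf sum_distrib_left[symmetric])
  \<comment> \<open>Weights lost by the first \<open>n i\<close> actions go to the last one, which absorbs the \<open>ln s\<close> term.\<close>
  also have "(\<Sum>j=1..n i. v j) - (\<Sum>j=1..n i. p j) = - (v (n i + 1) - p (n i + 1))"
    using sums by linarith
  also have "\<tau> * (\<Sum>j=1..n i. (v j - p j) * ln (p j)) - \<tau> * ln ?s * - (v (n i + 1) - p (n i + 1))
      = \<tau> * (\<Sum>j=1..n i + 1. (v j - p j) * ln (p j))"
    using p_last by (simp add: algebra_simps)
  also have "\<dots> = \<tau> * ((\<Sum>j=1..n i + 1. v j * ln (p j)) + - (\<Sum>j=1..n i + 1. p j * ln (p j)))"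
    by (simp only: left_diff_distrib sum_subtractf) simp
  also have "\<dots> \<le> \<tau> * (0 + ln (real (card {1..n i + 1})))"
  proof (intro mult_left_mono add_mono)
    show "(\<Sum>j=1..n i + 1. v j * ln (p j)) \<le> 0"
      using v p_pos p_le
      by (intro sum_nonpos mult_nonneg_nonpos ln_le_zero_iff[THEN iffD2]) (auto simp: simplex_of_def)
    show "- (\<Sum>j=1..n i + 1. p j * ln (p j)) \<le> ln (real (card {1..n i + 1}))"
      using p p_pos by (intro entropy_le_ln_card) (auto simp: simplex_of_def)
  qed (use \<tau> in auto)
  finally show ?thesis
    using utility_t_deviation[OF i, of n Q r x v]
    by (simp add: lift_joint_update_simplex[OF i v] utility_t_def)
qed

theorem proposition1:
  fixes N :: nat and n :: "nat \<Rightarrow> nat"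
    and Q :: "nat \<Rightarrow> nat \<Rightarrow> nat \<Rightarrow> nat \<Rightarrow> real" and r :: "nat \<Rightarrow> nat \<Rightarrow> real"
  assumes "N \<ge> 1" and "\<And>i. i \<in> {1..N} \<Longrightarrow> n i \<ge> 1"
  shows "\<exists>\<epsilon>\<^sub>0::real. \<epsilon>\<^sub>0 > 0 \<and>
    (\<forall>\<epsilon>::real. 0 < \<epsilon> \<and> \<epsilon> < \<epsilon>\<^sub>0 \<longrightarrow>
      (\<forall>\<tau>::real. 0 < \<tau> \<and> \<tau> \<le> \<epsilon> / (MAX i\<in>{1..N}. ln (real (n i + 1))) \<longrightarrow>
        (\<forall>x \<in> common_stationary_points N n Q r \<tau>.
           eps_nash N n Q r \<epsilon> (lift_joint N n x))))"
proof -
  define L where "L = (MAX i\<in>{1..N}. ln (real (n i + 1)))"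
  define B where "B = advantage_bound N n Q r"
  have L_ge: "ln (real (n i + 1)) \<le> L" if "i \<in> {1..N}" for i
    unfolding L_def using that by (intro Max_ge) auto
  have L: "L > 0"
  proof -
    have "0 < ln (real (n 1 + 1))"
      using assms(2)[of 1] assms(1) by (intro ln_gt_zero) simp
    also have "\<dots> \<le> L"
      using assms(1) by (intro L_ge) simp
    finally show ?thesis .
  qed
  have B: "B \<ge> 0"
    unfolding B_def by (rule advantage_bound_nonneg)
  \<comment> \<open>The threshold \<open>L / (B + 2)\<^sup>2\<close> for \<open>\<epsilon>\<close> is what \<open>1 / \<surd>\<tau> \<ge> B + 2\<close> requires through \<open>\<tau> \<le> \<epsilon> / L\<close>.\<close>
  have "eps_nash N n Q r \<epsilon> (lift_joint N n x)"
    if \<epsilon>: "\<epsilon> < L / (B + 2)\<^sup>2" and \<tau>: "0 < \<tau>" "\<tau> \<le> \<epsilon> / L"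
      and x: "x \<in> common_stationary_points N n Q r \<tau>" for \<epsilon> \<tau> x
  proof -
    have st: "x \<in> stationary_points N n (truncated_joint N n \<tau>) (objective N n Q r \<tau> i j)"
      if "i \<in> {1..N}" "j \<in> {1..n i}" for i j
      using x that unfolding common_stationary_points_def by blast
    have xt: "x \<in> truncated_joint N n \<tau>"
      using st[of 1 1] assms(2)[of 1] assms(1) by (simp add: stationary_points_def)
    have "\<epsilon> / L < L / (B + 2)\<^sup>2 / L"
      using \<epsilon> L by (rule divide_strict_right_mono)
    then have "\<tau> < 1 / (B + 2)\<^sup>2"
      using \<tau>(2) L by simp
    then have "sqrt \<tau> \<le> sqrt (1 / (B + 2)\<^sup>2)"
      by simp
    also have "\<dots> = 1 / (B + 2)"
      using B by (simp add: real_sqrt_divide)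
    finally have small: "B + 2 \<le> 1 / sqrt \<tau>"
      using B \<tau>(1) by (simp add: field_simps)
    have zero: "residual N n Q r \<tau> i j x = 0" if "i \<in> {1..N}" "j \<in> {1..n i}" for i j
      using residual_nonneg[OF st[OF that] that \<tau>(1)] residual_nonpos[OF st[OF that] that \<tau>(1)] small
      by (simp add: B_def)
    have "utility N n Q r i ((lift_joint N n x)(i := v)) - \<epsilon> \<le> utility N n Q r i (lift_joint N n x)"
      if i: "i \<in> {1..N}" and v: "v \<in> simplex_of n i" for i v
    proof -
      have "\<tau> * ln (real (n i + 1)) \<le> \<tau> * L"
        using L_ge[OF i] \<tau>(1) by (intro mult_left_mono) auto
      also have "\<dots> \<le> \<epsilon>"
        using \<tau>(2) L by (simp add: field_simps)
      finally show ?thesis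
        using gibbs_response_gain_le[OF xt i \<tau>(1) zero[OF i] v] by simp
    qed
    then show ?thesis
      using lift_truncated_joint[OF xt] by (simp add: eps_nash_def)
  qed
  moreover have "L / (B + 2)\<^sup>2 > 0"
    using L B by simp
  ultimately show ?thesis
    unfolding L_def[symmetric] by blast
qed

end
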